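(* For every $n\ge 4$, the smallest number of edges of a multigraph on $n$ vertices having no odd automorphism is $\left\lceil\frac34(n-1)\right\rceil$.
   Context: A multigraph on the vertices $\{1,\dots,n\}$ (undirected, without loops) is a family $(g_{\{i,j\}})_{1\le i<j\le n}$ of non-negative integers (edge multiplicities); its number of edges is $\sum g_{\{i,j\}}$, counted with multiplicity. An automorphism is a permutation $\sigma\in\mathfrak{S}_n$ of the vertices with $g_{\{\sigma(i),\sigma(j)\}}=g_{\{i,j\}}$ for all $i\neq j$; it is odd if $\sigma$ is an odd permutation of the vertices. *)

theory Defs
  imports Complex_Main "HOL-Library.FuncSet" "HOL-Combinatorics.Permutations"
begin

definition vertex_pairs :: "nat \<Rightarrow> nat set set" where
  "vertex_pairs n = {{i, j} | i j. 1 \<le> i \<and> i < j \<and> j \<le> n}"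

(* Families indexed by the unordered pairs; extensionality (value undefined off the
   index set) makes each multigraph correspond to exactly one function. *)
definition multigraphs :: "nat \<Rightarrow> (nat set \<Rightarrow> nat) set" where
  "multigraphs n = vertex_pairs n \<rightarrow>\<^sub>E UNIV"

definition num_edges :: "nat \<Rightarrow> (nat set \<Rightarrow> nat) \<Rightarrow> nat" where
  "num_edges n g = (\<Sum>e\<in>vertex_pairs n. g e)"

definition automorphism :: "nat \<Rightarrow> (nat set \<Rightarrow> nat) \<Rightarrow> (nat \<Rightarrow> nat) \<Rightarrow> bool" where
  "automorphism n g \<sigma> \<longleftrightarrow>
     \<sigma> permutes {1..n} \<and>
     (\<forall>i\<in>{1..n}. \<forall>j\<in>{1..n}. i \<noteq> j \<longrightarrow> g {\<sigma> i, \<sigma> j} = g {i, j})"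

definition has_odd_automorphism :: "nat \<Rightarrow> (nat set \<Rightarrow> nat) \<Rightarrow> bool" where
  "has_odd_automorphism n g \<longleftrightarrow> (\<exists>\<sigma>. automorphism n g \<sigma> \<and> \<not> evenperm \<sigma>)"

end

theory Submission
  imports Defs
begin

text \<open>
  Lower bound: exchanging two vertices \<open>a\<close>, \<open>b\<close> is an odd permutation, so every other
  pair must be separated by a third vertex. Hence at most one vertex is isolated, no two leaves have
  the same neighbour, and no two leaves are adjacent. Pairing each leaf (degree 1) with its
  neighbour (degree at least 2), the average degree of the non-isolated vertices is at least 3/2.

  Upper bound: if the vertices of degree other than 1 consist of the distinct neighbours of the leaves
  and of vertices with pairwise different degrees, an automorphism acts in the same way on the leaves
  and on their neighbours and fixes everything else, so it is even. This applies to a pendant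
  edge at each vertex of a (nearly) perfect matching, plus an isolated vertex if needed; for
  \<open>n mod 4 = 2\<close>, one matching edge is in addition subdivided.
\<close>

section \<open>Degrees and the handshake identity\<close>

definition degree :: "nat \<Rightarrow> (nat set \<Rightarrow> nat) \<Rightarrow> nat \<Rightarrow> nat" where
  "degree n g v = (\<Sum>w\<in>{1..n} - {v}. g {v, w})"

text \<open>Forgets multiplicities: the lower bound weighs vertices by \<open>degree\<close>, while
  the parity criterion only needs this support.\<close>

definition neighbours :: "nat \<Rightarrow> (nat set \<Rightarrow> nat) \<Rightarrow> nat \<Rightarrow> nat set" where
  "neighbours n g v = {w \<in> {1..n} - {v}. g {v, w} \<noteq> 0}"

lemma finite_vertex_pairs: "finite (vertex_pairs n)"
  by (rule finite_subset[of _ "Pow {1..n}"]) (auto simp: vertex_pairs_def)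

text \<open>Ordered pairs split into \<open>v < w\<close> and \<open>w < v\<close>; since
  \<open>{v, w}\<close> is unordered, each half sums to the number of edges.\<close>

lemma sum_degree: "(\<Sum>v\<in>{1..n}. degree n g v) = 2 * num_edges n g"
proof -
  have split: "degree n g v =
      (\<Sum>w\<in>{1..n}. if v < w then g {v, w} else 0) + (\<Sum>w\<in>{1..n}. if w < v then g {v, w} else 0)" for v
  proof -
    have "degree n g v = (\<Sum>w\<in>{1..n}. if w \<noteq> v then g {v, w} else 0)"
      unfolding degree_def by (rule sum.mono_neutral_cong_left) auto
    also have "\<dots> = (\<Sum>w\<in>{1..n}. (if v < w then g {v, w} else 0) + (if w < v then g {v, w} else 0))"
      by (rule sum.cong) auto
    finally show ?thesis by (simp add: sum.distrib)
  qed
  let ?P = "{(i, j). 1 \<le> i \<and> i < j \<and> j \<le> n}"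
  have "bij_betw (\<lambda>(i, j). {i, j}) ?P (vertex_pairs n)"
    by (force simp: bij_betw_def inj_on_def vertex_pairs_def doubleton_eq_iff)
  from sum.reindex_bij_betw[OF this, of g] have "num_edges n g = (\<Sum>(i, j)\<in>?P. g {i, j})"
    by (simp add: num_edges_def case_prod_beta)
  also have "\<dots> = (\<Sum>(i, j)\<in>{1..n} \<times> {1..n}. if i < j then g {i, j} else 0)"
    by (rule sum.mono_neutral_cong_left) (auto split: if_splits)
  finally have edges: "num_edges n g = (\<Sum>i\<in>{1..n}. \<Sum>j\<in>{1..n}. if i < j then g {i, j} else 0)"
    by (simp add: sum.cartesian_product)
  have "(\<Sum>v\<in>{1..n}. \<Sum>w\<in>{1..n}. if w < v then g {v, w} else 0) = num_edges n g"
    unfolding edges by (subst sum.swap) (intro sum.cong; simp add: insert_commute)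
  then show ?thesis unfolding split sum.distrib edges[symmetric] by simp
qed

section \<open>Lower bound\<close>

lemma separating_vertex:
  assumes "\<not> has_odd_automorphism n g" and "a \<in> {1..n}" "b \<in> {1..n}" "a \<noteq> b"
  obtains c where "c \<in> {1..n} - {a, b}" "g {a, c} \<noteq> g {b, c}"
proof (rule ccontr)
  assume "\<not> thesis"
  with that have same: "g {a, c} = g {b, c}" if "c \<in> {1..n}" "c \<noteq> a" "c \<noteq> b" for c
    using \<open>\<not> thesis\<close> that by blast
  have "g {transpose a b i, transpose a b j} = g {i, j}"
    if "i \<in> {1..n}" "j \<in> {1..n}" "i \<noteq> j" for i j
    using that same[of i] same[of j] \<open>a \<noteq> b\<close>
    by (auto simp: transpose_def insert_commute)
  then have "automorphism n g (transpose a b)"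
    using assms by (auto simp: automorphism_def intro: permutes_swap_id)
  moreover have "\<not> evenperm (transpose a b)"
    using \<open>a \<noteq> b\<close> by (simp add: evenperm_swap)
  ultimately show False using assms(1) by (auto simp: has_odd_automorphism_def)
qed

lemma degree_one_neighbour:
  assumes "degree n g v = 1"
  obtains w where "w \<in> {1..n} - {v}" "g {v, w} = 1"
    "\<And>u. u \<in> {1..n} - {v} \<Longrightarrow> u \<noteq> w \<Longrightarrow> g {v, u} = 0"
proof -
  have "\<exists>w\<in>{1..n} - {v}. g {v, w} = 1 \<and> (\<forall>u\<in>{1..n} - {v}. w \<noteq> u \<longrightarrow> g {v, u} = 0)"
    using assms unfolding degree_def by (subst (asm) sum_eq_1_iff) blast+
  then obtain w where "w \<in> {1..n} - {v}" "g {v, w} = 1"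
      "\<forall>u\<in>{1..n} - {v}. w \<noteq> u \<longrightarrow> g {v, u} = 0"
    by blast
  then show ?thesis by (intro that[of w]) simp_all
qed

text \<open>Discharging with charge \<open>2 * degree n g v - 3\<close>. A leaf has charge -1,
  compensated by its neighbour \<open>p v\<close>, whose charge is at least 1; an isolated vertex
  has charge -3 and occurs at most once; all other charges are nonnegative. By the handshake
  identity the total is \<open>4 * num_edges n g - 3 * n\<close>.\<close>

lemma num_edges_lower_bound:
  assumes no_odd: "\<not> has_odd_automorphism n g"
  shows "3 * n \<le> 4 * num_edges n g + 3"
proof -
  define V where "V = {1..n}"
  define Iso where "Iso = {v\<in>V. degree n g v = 0}"
  define L where "L = {v\<in>V. degree n g v = 1}"
  have fin: "finite V" "finite Iso" "finite L" by (auto simp: V_def Iso_def L_def)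
  have zero: "g {v, u} = 0" if "v \<in> Iso" "u \<in> V" "u \<noteq> v" for u v
    using that by (auto simp: Iso_def degree_def V_def)
  have "a = b" if "a \<in> Iso" "b \<in> Iso" for a b
  proof (rule ccontr)
    assume "a \<noteq> b"
    moreover have "a \<in> {1..n}" "b \<in> {1..n}" using that by (auto simp: Iso_def V_def)
    ultimately obtain c where "c \<in> {1..n} - {a, b}" "g {a, c} \<noteq> g {b, c}"
      using separating_vertex[OF no_odd] by blast
    with zero that show False by (auto simp: V_def)
  qed
  then have card_Iso: "card Iso \<le> 1" using fin by (auto simp: card_le_Suc0_iff_eq)
  have "\<forall>v\<in>L. \<exists>w. w \<in> V - {v} \<and> g {v, w} = 1 \<and> (\<forall>u\<in>V - {v}. u \<noteq> w \<longrightarrow> g {v, u} = 0)"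
  proof
    fix v assume "v \<in> L"
    then have "degree n g v = 1" by (simp add: L_def)
    then show "\<exists>w. w \<in> V - {v} \<and> g {v, w} = 1 \<and> (\<forall>u\<in>V - {v}. u \<noteq> w \<longrightarrow> g {v, u} = 0)"
      unfolding V_def by (rule degree_one_neighbour) blast
  qed
  then obtain p where p: "\<And>v. v \<in> L \<Longrightarrow> p v \<in> V - {v}" "\<And>v. v \<in> L \<Longrightarrow> g {v, p v} = 1"
      "\<And>v u. v \<in> L \<Longrightarrow> u \<in> V - {v} \<Longrightarrow> u \<noteq> p v \<Longrightarrow> g {v, u} = 0"
    by metis
  \<comment> \<open>No third vertex separates two leaves with a common neighbour: both
    multiplicities are 1 at that neighbour and 0 elsewhere.\<close>
  have inj: "inj_on p L"
  proof (rule inj_onI, rule ccontr)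
    fix a b assume ab: "a \<in> L" "b \<in> L" "p a = p b" "a \<noteq> b"
    moreover have "a \<in> {1..n}" "b \<in> {1..n}" using ab by (auto simp: L_def V_def)
    ultimately obtain c where "c \<in> {1..n} - {a, b}" "g {a, c} \<noteq> g {b, c}"
      using separating_vertex[OF no_odd] by blast
    then show False using ab p(2)[of a] p(2)[of b] p(3)[of a c] p(3)[of b c]
      by (cases "c = p a") (auto simp: V_def)
  qed
  have deg2: "degree n g (p v) \<ge> 2" if v: "v \<in> L" for v
  proof -
    have "v \<in> V" using v by (simp add: L_def)
    have "g {p v, v} \<le> degree n g (p v)"
      unfolding degree_def using p(1)[OF v] \<open>v \<in> V\<close>
      by (intro member_le_sum) (auto simp: V_def)
    then have "degree n g (p v) \<ge> 1" using p(2)[OF v] by (simp add: insert_commute)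
    \<comment> \<open>Otherwise \<open>v\<close> and \<open>p v\<close> would be joined to each
      other and to nothing else, so no third vertex could separate them.\<close>
    moreover have "degree n g (p v) \<noteq> 1"
    proof
      assume one: "degree n g (p v) = 1"
      then have pL: "p v \<in> L" using p(1)[OF v] by (simp add: L_def)
      have "p (p v) = v"
        using p(1)[OF v] p(2)[OF v] p(3)[OF pL, of v] \<open>v \<in> V\<close> insert_commute[of v "p v" "{}"]
        by auto
      moreover have "v \<in> {1..n}" "p v \<in> {1..n}" "v \<noteq> p v"
        using p(1)[OF v] \<open>v \<in> V\<close> by (auto simp: V_def)
      then obtain c where "c \<in> {1..n} - {v, p v}" "g {v, c} \<noteq> g {p v, c}"
        by (rule separating_vertex[OF no_odd])
      ultimately show False using p(3)[OF v, of c] p(3)[OF pL, of c] by (auto simp: V_def)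
    qed
    ultimately show ?thesis by linarith
  qed
  have disj: "p ` L \<inter> L = {}" "p ` L \<inter> Iso = {}" "L \<inter> Iso = {}"
    using deg2 by (fastforce simp: L_def Iso_def)+
  have sub: "p ` L \<subseteq> V" using p(1) by auto
  \<comment> \<open>The charge, taken in \<open>int\<close> because it is negative on
    \<open>L\<close> and \<open>Iso\<close>; \<open>?W\<close> collects the vertices of degree at
    least 2 that compensate no leaf.\<close>
  let ?e = "\<lambda>v. 2 * int (degree n g v) - 3"
  let ?W = "V - Iso - L - p ` L"
  have V_eq: "V = ?W \<union> (p ` L \<union> (L \<union> Iso))"
    using sub by (auto simp: L_def Iso_def)
  have "(\<Sum>v\<in>V. ?e v) = (\<Sum>v\<in>?W. ?e v) + ((\<Sum>v\<in>p ` L. ?e v) + ((\<Sum>v\<in>L. ?e v) + (\<Sum>v\<in>Iso. ?e v)))"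
    using fin disj by (subst V_eq, subst sum.union_disjoint; auto simp: sum.union_disjoint Int_Un_distrib)
  moreover have "(\<Sum>v\<in>?W. ?e v) \<ge> 0"
  proof (rule sum_nonneg)
    fix v assume "v \<in> ?W"
    then have "degree n g v \<noteq> 0" "degree n g v \<noteq> 1" by (auto simp: L_def Iso_def)
    then show "0 \<le> ?e v" by linarith
  qed
  moreover have "(\<Sum>v\<in>p ` L. ?e v) \<ge> int (card L)"
  proof -
    have "(\<Sum>v\<in>p ` L. ?e v) \<ge> (\<Sum>v\<in>p ` L. 1)"
      using deg2 by (intro sum_mono) fastforce
    then show ?thesis using inj by (simp add: card_image)
  qed
  moreover have "(\<Sum>v\<in>L. ?e v) = - int (card L)"
    by (simp add: L_def)
  moreover have "(\<Sum>v\<in>Iso. ?e v) = - 3 * int (card Iso)"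
    by (simp add: Iso_def)
  ultimately have "(\<Sum>v\<in>V. ?e v) \<ge> - 3" using card_Iso by linarith
  moreover have "(\<Sum>v\<in>V. ?e v) = 2 * int (\<Sum>v\<in>V. degree n g v) - 3 * int n"
    by (simp add: sum_subtractf sum_distrib_left V_def)
  ultimately have "2 * int (2 * num_edges n g) - 3 * int n \<ge> - 3"
    using sum_degree[of n g] unfolding V_def by linarith
  then show ?thesis by linarith
qed

section \<open>Parity criterion for permutations and automorphisms\<close>

text \<open>Let \<open>\<alpha>\<close> be \<open>\<sigma>\<close> on \<open>A\<close> and the
  identity elsewhere, and \<open>t\<close> the involution exchanging each \<open>a\<close> with
  \<open>p a\<close>. Then \<open>\<sigma>\<close> is \<open>\<alpha>\<close> composed with its
  conjugate by \<open>t\<close>, and conjugation preserves parity.\<close>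

lemma evenperm_paired:
  assumes "finite A" and \<sigma>: "\<sigma> permutes A \<union> p ` A"
    and inj: "inj_on p A" and disj: "A \<inter> p ` A = {}"
    and inv: "\<sigma> ` A \<subseteq> A" and comm: "\<And>a. a \<in> A \<Longrightarrow> \<sigma> (p a) = p (\<sigma> a)"
  shows "evenperm \<sigma>"
proof -
  define \<alpha> where "\<alpha> x = (if x \<in> A then \<sigma> x else x)" for x
  define t where "t x = (if x \<in> A then p x else if x \<in> p ` A then the_inv_into A p x else x)" for x
  have t1: "t a = p a" "t (p a) = a" if "a \<in> A" for a
    using that disj inj by (auto simp: t_def the_inv_into_f_f)
  have t_other: "t x = x" if "x \<notin> A" "x \<notin> p ` A" for x using that by (simp add: t_def)
  have tt: "t (t x) = x" for x
  proof (cases "x \<in> A \<union> p ` A")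
    case True
    then show ?thesis using t1 by auto
  next
    case False
    then show ?thesis using t_other by simp
  qed
  have "bij_betw \<sigma> A A"
    using inv \<open>finite A\<close> permutes_inj_on[OF \<sigma>, of A]
    by (simp add: bij_betw_def endo_inj_surj)
  then have "bij_betw \<alpha> A A" by (simp add: \<alpha>_def cong: bij_betw_cong)
  then have \<alpha>: "\<alpha> permutes A" by (intro bij_imp_permutes) (auto simp: \<alpha>_def)
  have "t permutes A \<union> p ` A"
    using t_other tt by (auto simp: permutes_def) metis
  then have perm: "permutation \<alpha>" "permutation t"
    using \<alpha> \<open>finite A\<close> by (auto intro: permutes_imp_permutation[rotated])
  have pA: "p a \<notin> A" if "a \<in> A" for a using that disj by auto
  \<comment> \<open>At \<open>p a\<close> the factors give \<open>a\<close>,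
    \<open>\<sigma> a\<close>, \<open>p (\<sigma> a)\<close> in turn, and the last
    \<open>\<alpha>\<close> fixes this point, which lies outside \<open>A\<close>.\<close>
  have "\<sigma> x = (\<alpha> \<circ> (t \<circ> (\<alpha> \<circ> t))) x" for x
  proof -
    consider (A) "x \<in> A" | (p) a where "a \<in> A" "x = p a" | (o) "x \<notin> A" "x \<notin> p ` A" by blast
    then show ?thesis
    proof cases
      case A
      then show ?thesis using pA by (simp add: t1 \<alpha>_def)
    next
      case p
      then have "\<sigma> a \<in> A" using inv by auto
      then show ?thesis using p pA comm by (simp add: t1 \<alpha>_def)
    next
      case o
      then show ?thesis using permutes_not_in[OF \<sigma>] by (simp add: t_other \<alpha>_def)
    qed
  qed
  then have "\<sigma> = \<alpha> \<circ> (t \<circ> (\<alpha> \<circ> t))" by auto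
  then show ?thesis using perm by (auto simp: evenperm_comp permutation_compose)
qed

lemma neighbours_automorphism:
  assumes "automorphism n g \<sigma>" "v \<in> {1..n}"
  shows "neighbours n g (\<sigma> v) = \<sigma> ` neighbours n g v"
proof -
  have g: "g {\<sigma> i, \<sigma> j} = g {i, j}"
    if "i \<in> {1..n}" "j \<in> {1..n}" "i \<noteq> j" for i j
    using assms that by (auto simp: automorphism_def)
  have \<sigma>: "\<sigma> permutes {1..n}" using assms(1) by (simp add: automorphism_def)
  have "w \<in> neighbours n g (\<sigma> v) \<longleftrightarrow> w \<in> \<sigma> ` neighbours n g v" for w
  proof -
    obtain u where u: "w = \<sigma> u" using permutes_surj[OF \<sigma>] by blast
    have "\<sigma> u \<in> neighbours n g (\<sigma> v) \<longleftrightarrow> u \<in> neighbours n g v"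
      using g[OF assms(2), of u] permutes_in_image[OF \<sigma>, of u] injD[OF permutes_inj[OF \<sigma>], of u v]
      by (cases "u = v") (auto simp: neighbours_def)
    then show ?thesis using u by (auto simp: inj_image_mem_iff[OF permutes_inj[OF \<sigma>]])
  qed
  then show ?thesis by blast
qed

lemma no_odd_automorphism_if_paired:
  assumes L: "L \<subseteq> {1..n}" and inj: "inj_on p L"
    and leaf: "\<And>v. v \<in> L \<Longrightarrow> neighbours n g v = {p v}"
    and nonleaf: "\<And>v. v \<in> {1..n} - L \<Longrightarrow> card (neighbours n g v) \<noteq> 1"
    and disj: "L \<inter> p ` L = {}"
    and rest: "inj_on (\<lambda>v. card (neighbours n g v)) ({1..n} - L - p ` L)"
  shows "\<not> has_odd_automorphism n g"
proof -
  have "evenperm \<sigma>" if aut: "automorphism n g \<sigma>" for \<sigma>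
  proof -
    have \<sigma>: "\<sigma> permutes {1..n}" using aut by (simp add: automorphism_def)
    have inj\<sigma>: "inj \<sigma>" by (rule permutes_inj[OF \<sigma>])
    have nb: "neighbours n g (\<sigma> v) = \<sigma> ` neighbours n g v" if "v \<in> {1..n}" for v
      using neighbours_automorphism[OF aut that] .
    have card: "card (neighbours n g (\<sigma> v)) = card (neighbours n g v)" if "v \<in> {1..n}" for v
      using nb[OF that] inj\<sigma> by (simp add: card_image inj_on_subset)
    have in_V: "\<sigma> v \<in> {1..n} \<longleftrightarrow> v \<in> {1..n}" for v using permutes_in_image[OF \<sigma>] .
    have L_iff: "v \<in> L \<longleftrightarrow> card (neighbours n g v) = 1" if "v \<in> {1..n}" for v
      using leaf[of v] nonleaf[of v] that by auto
    have \<sigma>L: "\<sigma> v \<in> L \<longleftrightarrow> v \<in> L" if "v \<in> {1..n}" for v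
      using L_iff[OF that] L_iff[of "\<sigma> v"] card[OF that] in_V that by auto
    \<comment> \<open>Both sides are the only neighbour of the leaf
      \<open>\<sigma> v\<close>.\<close>
    have comm: "\<sigma> (p v) = p (\<sigma> v)" if "v \<in> L" for v
    proof -
      have "v \<in> {1..n}" using that L by auto
      then show ?thesis using nb[of v] leaf[OF that] leaf[of "\<sigma> v"] \<sigma>L that by auto
    qed
    have "\<sigma> ` L = L"
      using \<sigma>L L inj\<sigma> finite_subset[OF L] by (intro endo_inj_surj) (auto simp: inj_on_subset)
    then have "\<sigma> ` p ` L = p ` L"
      using comm by (metis (no_types, lifting) image_cong image_image)
    then have \<sigma>pL: "\<sigma> v \<in> p ` L \<longleftrightarrow> v \<in> p ` L" for v
      using inj_image_mem_iff[OF inj\<sigma>] by metis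
    have fixed: "\<sigma> v = v" if "v \<notin> L \<union> p ` L" for v
    proof (cases "v \<in> {1..n}")
      case True
      then show ?thesis
        using inj_onD[OF rest card[OF True]] \<sigma>L[OF True] \<sigma>pL[of v] in_V[of v] that by auto
    next
      case False
      then show ?thesis using permutes_not_in[OF \<sigma>] by auto
    qed
    have "\<sigma> permutes L \<union> p ` L"
      using \<sigma> fixed by (auto simp: permutes_def)
    then show ?thesis
      using \<open>\<sigma> ` L = L\<close> comm inj disj finite_subset[OF L]
      by (intro evenperm_paired[of L \<sigma> p]) auto
  qed
  then show ?thesis by (auto simp: has_odd_automorphism_def)
qed

section \<open>Simple graphs with pendant edges\<close>

text \<open>\<open>restrict\<close> makes the function extensional, as \<open>multigraphs\<close>
  demands. Members of \<open>E\<close> that are not pairs of vertices are ignored, so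
  \<open>card E\<close> bounds the number of edges from above without further checks.\<close>

definition graph_of :: "nat \<Rightarrow> nat set set \<Rightarrow> nat set \<Rightarrow> nat" where
  "graph_of n E = restrict (\<lambda>e. of_bool (e \<in> E)) (vertex_pairs n)"

lemma graph_of_multigraph: "graph_of n E \<in> multigraphs n"
  by (simp add: graph_of_def multigraphs_def)

lemma num_edges_graph_of_le:
  assumes "finite E"
  shows "num_edges n (graph_of n E) \<le> card E"
proof -
  have "num_edges n (graph_of n E) = card (vertex_pairs n \<inter> E)"
    using finite_vertex_pairs by (simp add: num_edges_def graph_of_def Int_def)
  then show ?thesis using assms by (simp add: card_mono)
qed

lemma neighbours_graph_of:
  assumes "v \<in> {1..n}"
  shows "neighbours n (graph_of n E) v = {w \<in> {1..n} - {v}. {v, w} \<in> E}"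
proof -
  have "{v, w} \<in> vertex_pairs n" if "w \<in> {1..n} - {v}" for w
    using that assms unfolding vertex_pairs_def
    by (cases "v < w") (fastforce simp: doubleton_eq_iff)+
  then show ?thesis by (auto simp: neighbours_def graph_of_def)
qed

text \<open>Fixes the numbering of all constructions: core \<open>1..h\<close>, leaf
  \<open>i + h\<close> hanging from \<open>i\<close>, leftover vertices from
  \<open>2 * h + 1\<close> on.\<close>

definition pendants :: "nat \<Rightarrow> nat set set" where
  "pendants h = (\<lambda>i. {i, i + h}) ` {1..h}"

text \<open>The paired criterion with leaves \<open>h + 1..2 * h\<close> and
  \<open>p v = v - h\<close>. The assumption \<open>core\<close> keeps leaves free of further edges,
  \<open>cover\<close> prevents core vertices from being leaves, and the last two assumptions
  control the leftover vertices.\<close>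

lemma no_odd_automorphism_pendants:
  assumes h: "2 * h \<le> n"
    and core: "\<And>e. e \<in> H \<Longrightarrow> e \<inter> {h + 1..2 * h} = {}"
    and cover: "\<And>v. v \<in> {1..h} \<Longrightarrow> \<exists>w \<in> {1..n} - {v}. {v, w} \<in> H"
    and nonleaf: "\<And>v. v \<in> {2 * h + 1..n} \<Longrightarrow> card {w \<in> {1..n} - {v}. {v, w} \<in> H} \<noteq> 1"
    and rest: "inj_on (\<lambda>v. card {w \<in> {1..n} - {v}. {v, w} \<in> H}) {2 * h + 1..n}"
  shows "\<not> has_odd_automorphism n (graph_of n (pendants h \<union> H))"
proof -
  let ?N = "neighbours n (graph_of n (pendants h \<union> H))"
  have image: "(\<lambda>v. v - h) ` {h + 1..2 * h} = {1..h}"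
    by (force simp: image_iff intro: bexI[of _ "_ + h"])
  have outer: "?N v = {w \<in> {1..n} - {v}. {v, w} \<in> H}" if "v \<in> {2 * h + 1..n}" for v
    using that by (auto simp: neighbours_graph_of pendants_def doubleton_eq_iff)
  \<comment> \<open>A core vertex has two distinct neighbours: its leaf \<open>v + h\<close> and a
    vertex \<open>w\<close> given by \<open>cover\<close>.\<close>
  have "card (?N v) \<noteq> 1" if v: "v \<in> {1..h}" for v
  proof -
    obtain w where w: "w \<in> {1..n} - {v}" "{v, w} \<in> H" using cover[OF v] by blast
    then have "w \<in> ?N v" using v h by (auto simp: neighbours_graph_of)
    moreover have "v + h \<in> ?N v" using v h by (auto simp: neighbours_graph_of pendants_def)
    moreover have "w \<noteq> v + h" using core[OF w(2)] v by auto
    ultimately show ?thesis by (auto simp: card_1_singleton_iff)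
  qed
  moreover have "card (?N v) \<noteq> 1" if "v \<in> {2 * h + 1..n}" for v
    using outer[OF that] nonleaf[OF that] by simp
  moreover have "v \<in> {1..h} \<or> v \<in> {2 * h + 1..n}" if "v \<in> {1..n} - {h + 1..2 * h}" for v
    using that by auto
  moreover have "?N v = {v - h}" if v: "v \<in> {h + 1..2 * h}" for v
  proof -
    have "?N v = {w \<in> {1..n} - {v}. {v, w} \<in> pendants h}"
      using v h core[of "{v, _}"] by (auto simp: neighbours_graph_of)
    also have "\<dots> = {v - h}"
    proof (intro equalityI subsetI)
      fix w assume "w \<in> {w \<in> {1..n} - {v}. {v, w} \<in> pendants h}"
      then show "w \<in> {v - h}" using v by (auto simp: pendants_def doubleton_eq_iff)
    next
      fix w assume "w \<in> {v - h}"
      then show "w \<in> {w \<in> {1..n} - {v}. {v, w} \<in> pendants h}"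
        using v h by (auto simp: pendants_def doubleton_eq_iff intro!: image_eqI[of _ _ "v - h"])
    qed
    finally show ?thesis .
  qed
  moreover have "inj_on (\<lambda>v. card (?N v)) ({1..n} - {h + 1..2 * h} - {1..h})"
  proof -
    have "{1..n} - {h + 1..2 * h} - {1..h} = {2 * h + 1..n}" by auto
    moreover have "inj_on (\<lambda>v. card (?N v)) {2 * h + 1..n}"
      using rest by (rule inj_on_cong[THEN iffD2, rotated]) (simp only: outer)
    ultimately show ?thesis by (simp only:)
  qed
  ultimately show ?thesis
    using h image by (intro no_odd_automorphism_if_paired[of "{h + 1..2 * h}" n "\<lambda>v. v - h"])
      (auto intro: inj_on_diff_nat)
qed

lemma card_pendants_Un_le: "card (pendants h \<union> H) \<le> h + card H"
proof -
  have "card (pendants h) \<le> h" unfolding pendants_def using card_image_le[of "{1..h}"] by simp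
  then show ?thesis using card_Un_le[of "pendants h" H] by linarith
qed

section \<open>Constructions attaining the bound\<close>

text \<open>For \<open>h = 2 * m\<close> the core edges form a perfect matching. For
  \<open>h = 2 * m + 1\<close> the two edges at \<open>m + 1\<close> form the path \<open>1\<close>,
  \<open>m + 1\<close>, \<open>2 * m + 1\<close>, and the others are disjoint. There are at most
  \<open>h\<close> pendant edges and \<open>h - m\<close> core edges.\<close>

lemma exists_multigraph_matching:
  assumes h: "2 * h \<le> n" "n \<le> 2 * h + 1" and m: "1 \<le> m" "2 * m \<le> h" "h \<le> 2 * m + 1"
  shows "\<exists>g\<in>multigraphs n. \<not> has_odd_automorphism n g \<and> num_edges n g \<le> 2 * h - m"
proof -
  define H where "H = (\<lambda>i. {i, i + m}) ` {1..h - m}"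
  have "\<not> has_odd_automorphism n (graph_of n (pendants h \<union> H))"
  proof (rule no_odd_automorphism_pendants)
    show "e \<inter> {h + 1..2 * h} = {}" if "e \<in> H" for e
      using that m by (auto simp: H_def)
    show "\<exists>w\<in>{1..n} - {v}. {v, w} \<in> H" if v: "v \<in> {1..h}" for v
    proof (cases "v \<le> h - m")
      case True
      then show ?thesis using v m h by (intro bexI[of _ "v + m"]) (auto simp: H_def)
    next
      case False
      then show ?thesis using v m h
        by (intro bexI[of _ "v - m"]) (auto simp: H_def intro!: image_eqI[of _ _ "v - m"])
    qed
    have "{w \<in> {1..n} - {v}. {v, w} \<in> H} = {}" if "v \<in> {2 * h + 1..n}" for v
      using that m by (auto simp: H_def doubleton_eq_iff)
    then show "card {w \<in> {1..n} - {v}. {v, w} \<in> H} \<noteq> 1" if "v \<in> {2 * h + 1..n}" for v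
      using that by (metis card.empty zero_neq_one)
    \<comment> \<open>At most one vertex is left over.\<close>
    show "inj_on (\<lambda>v. card {w \<in> {1..n} - {v}. {v, w} \<in> H}) {2 * h + 1..n}"
      using h by (auto intro!: inj_onI)
  qed (use h in simp)
  moreover have "card H \<le> h - m" unfolding H_def using card_image_le[of "{1..h - m}"] by simp
  then have "card (pendants h \<union> H) \<le> 2 * h - m"
    using card_pendants_Un_le[of h H] m by linarith
  moreover have "finite (pendants h \<union> H)" by (simp add: pendants_def H_def)
  ultimately show ?thesis
    using graph_of_multigraph num_edges_graph_of_le le_trans by blast
qed

text \<open>Taking \<open>h = 2 * m + 1\<close> in the matching construction would allow
  \<open>3 * m + 2\<close> edges, one too many. With \<open>h = 2 * m\<close> two vertices are left
  over: \<open>n\<close> subdivides the matching edge between \<open>1\<close> and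
  \<open>m + 1\<close>, and \<open>n - 1\<close> stays isolated, so their numbers of neighbours, 2
  and 0, differ.\<close>

lemma exists_multigraph_subdivided:
  assumes m: "1 \<le> m" and n: "n = 4 * m + 2"
  shows "\<exists>g\<in>multigraphs n. \<not> has_odd_automorphism n g \<and> num_edges n g \<le> 3 * m + 1"
proof -
  define M where "M = (\<lambda>i. {i, i + m}) ` {2..m}"
  define H where "H = {{1, n}, {m + 1, n}} \<union> M"
  have "\<not> has_odd_automorphism n (graph_of n (pendants (2 * m) \<union> H))"
  proof (rule no_odd_automorphism_pendants)
    show "e \<inter> {2 * m + 1..2 * (2 * m)} = {}" if "e \<in> H" for e
      using that m n by (auto simp: H_def M_def)
    show "\<exists>w\<in>{1..n} - {v}. {v, w} \<in> H" if v: "v \<in> {1..2 * m}" for v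
    proof -
      consider "v = 1 \<or> v = m + 1" | "2 \<le> v" "v \<le> m" | "m + 2 \<le> v" using v by force
      then show ?thesis
      proof cases
        case 1
        then show ?thesis using n m by (intro bexI[of _ n]) (auto simp: H_def)
      next
        case 2
        then show ?thesis using n m by (intro bexI[of _ "v + m"]) (auto simp: H_def M_def)
      next
        case 3
        then show ?thesis using v m n
          by (intro bexI[of _ "v - m"]) (auto simp: H_def M_def intro!: image_eqI[of _ _ "v - m"])
      qed
    qed
    define f where "f v = card {w \<in> {1..n} - {v}. {v, w} \<in> H}" for v
    have outer: "{2 * (2 * m) + 1..n} = {n - 1, n}" using n by auto
    have "n - 1 \<notin> e" if "e \<in> H" for e
      using that m n by (auto simp: H_def M_def)
    then have "{w \<in> {1..n} - {n - 1}. {n - 1, w} \<in> H} = {}" by blast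
    then have c0: "f (n - 1) = 0" unfolding f_def by (simp only: card.empty)
    have "n \<notin> e" if "e \<in> M" for e
      using that n by (auto simp: M_def)
    then have nH: "{n, w} \<in> H \<longleftrightarrow> {n, w} = {1, n} \<or> {n, w} = {m + 1, n}" for w
      unfolding H_def by blast
    then have "{w \<in> {1..n} - {n}. {n, w} \<in> H} = {1, m + 1}"
    proof -
      have "n \<noteq> 1" "n \<noteq> m + 1" "1 \<le> n" "m + 1 \<le> n" using n by auto
      moreover have "{n, w} \<in> H \<longleftrightarrow> w = 1 \<or> w = m + 1" if "w \<noteq> n" for w
        using nH[of w] that unfolding doubleton_eq_iff by blast
      ultimately show ?thesis by auto
    qed
    then have c2: "f n = 2" using m unfolding f_def by simp
    show "card {w \<in> {1..n} - {v}. {v, w} \<in> H} \<noteq> 1" if "v \<in> {2 * (2 * m) + 1..n}" for v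
      using that c0 c2 unfolding outer f_def[symmetric] by auto
    show "inj_on (\<lambda>v. card {w \<in> {1..n} - {v}. {v, w} \<in> H}) {2 * (2 * m) + 1..n}"
      using c0 c2 unfolding outer f_def[symmetric] by (auto simp: inj_on_def)
  qed (use n in simp)
  moreover have "card M \<le> m - 1" unfolding M_def using card_image_le[of "{2..m}"] by simp
  then have "card H \<le> m + 1"
    using m card_Un_le[of "{{1, n}, {m + 1, n}}" M] card_insert_le_m1[of 2 "{{m + 1, n}}" "{1, n}"]
    by (simp add: H_def del: Un_insert_left)
  then have "card (pendants (2 * m) \<union> H) \<le> 3 * m + 1"
    using card_pendants_Un_le[of "2 * m" H] by linarith
  moreover have "finite (pendants (2 * m) \<union> H)" by (simp add: pendants_def H_def M_def)
  ultimately show ?thesis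
    using graph_of_multigraph num_edges_graph_of_le le_trans by blast
qed

text \<open>A division-free form of the upper bound, uniform in the residue of \<open>n\<close>
  modulo 4.\<close>

lemma exists_multigraph:
  assumes "n \<ge> 4"
  shows "\<exists>g\<in>multigraphs n. \<not> has_odd_automorphism n g \<and> 4 * num_edges n g \<le> 3 * n"
proof (cases "n mod 4 = 2")
  case True
  define m where "m = n div 4"
  have "1 \<le> m" "n = 4 * m + 2" using assms True unfolding m_def by presburger+
  then show ?thesis using exists_multigraph_subdivided[of m n] by fastforce
next
  case False
  define m where "m = n div 4"
  have "1 \<le> m" using assms by (simp add: m_def)
  have "n = 4 * m + n mod 4" "n mod 4 < 4" by (simp_all add: m_def)
  \<comment> \<open>The first case takes \<open>h = 2 * m\<close> with at most \<open>3 * m\<close>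
    edges, the second \<open>h = 2 * m + 1\<close> with at most \<open>3 * m + 2\<close>.\<close>
  with False consider "n = 4 * m \<or> n = 4 * m + 1" | "n = 4 * m + 3" by linarith
  then show ?thesis
  proof cases
    case 1
    then show ?thesis using exists_multigraph_matching[of "2 * m" n m] \<open>1 \<le> m\<close> by fastforce
  next
    case 2
    then show ?thesis using exists_multigraph_matching[of "2 * m + 1" n m] \<open>1 \<le> m\<close> by fastforce
  qed
qed

theorem lemma3p2:
  fixes n :: nat
  assumes "n \<ge> 4"
  shows "(\<exists>g\<in>multigraphs n. \<not> has_odd_automorphism n g \<and>
            int (num_edges n g) = \<lceil>3 / 4 * (real n - 1)\<rceil>) \<and>
         (\<forall>g\<in>multigraphs n. \<not> has_odd_automorphism n g \<longrightarrow>
            \<lceil>3 / 4 * (real n - 1)\<rceil> \<le> int (num_edges n g))"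
proof -
  have lower: "3 / 4 * (real n - 1) \<le> real (num_edges n g)"
    if "\<not> has_odd_automorphism n g" for g
  proof -
    have "real (3 * n) \<le> real (4 * num_edges n g + 3)"
      using num_edges_lower_bound[OF that] by (simp only: of_nat_le_iff)
    then show ?thesis by simp
  qed
  obtain g where g: "g \<in> multigraphs n" "\<not> has_odd_automorphism n g" "4 * num_edges n g \<le> 3 * n"
    using exists_multigraph[OF assms] by blast
  have "real (4 * num_edges n g) \<le> real (3 * n)" using g(3) by (simp only: of_nat_le_iff)
  \<comment> \<open>For integers, \<open>4 * num_edges n g \<le> 3 * n\<close> says exactly that
    \<open>num_edges n g - 1\<close> lies strictly below \<open>3 / 4 * (n - 1)\<close>, as
    uniqueness of the ceiling requires.\<close>
  then have "int (num_edges n g) = \<lceil>3 / 4 * (real n - 1)\<rceil>"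
    using lower[OF g(2)] by (intro ceiling_unique[symmetric]) auto
  then show ?thesis using g lower by (auto simp: ceiling_le_iff)
qed

end
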